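(* Let $\mathcal G=(\mathcal V,\mathcal E)$ be a strongly connected directed graph without self loops, with node set $\mathcal V=\{1,\dots,n\}$, $n\ge 2$, and adjacency matrix $A$, and let $(X_t^{\rm RB})_{t\ge 0}$ be a continuous-time Ruelle-Bowen random walk on $\mathcal G$. Let $t_f>0$, let $i,j\in\mathcal V$, and let $N\ge 0$ be an integer. For a path $v=(v_0,v_1,\dots,v_N)$ in $\mathcal G$ with $v_0=i$, $v_N=j$ and $(v_{k},v_{k+1})\in\mathcal E$ for $0\le k<N$, let $p(v)$ be the probability that $X^{\rm RB}$ starts at $X^{\rm RB}_0=i$, makes exactly $N$ jumps during the time window $[0,t_f]$, and the successive nodes it occupies during $[0,t_f]$ are $v_0,v_1,\dots,v_N$ in this order (so $X^{\rm RB}_{t_f}=j$). Then $p(v)$ is independent of the particular path: $p(v)=p(w)$ for any two such $N$-step paths $v,w$ from $i$ to $j$.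
   Context: Let $\lambda_A>0$ be the Frobenius-Perron eigenvalue (spectral radius) of the $0/1$ adjacency matrix $A=[a_{ij}]$ ($a_{ij}=1$ iff $(i,j)\in\mathcal E$), and let $\varphi$ be a corresponding right eigenvector with positive entries, $A\varphi=\lambda_A\varphi$. The continuous-time Ruelle-Bowen (RB) random walk on $\mathcal G$ is the time-homogeneous Markov jump process on $\mathcal V$, with right-continuous piecewise constant paths, whose infinitesimal generator is $$Q^{\rm RB}=\operatorname{diag}(\varphi)^{-1}A\operatorname{diag}(\varphi)-\lambda_A I,$$ i.e. whose transition probabilities are $[p_{ij}(t)]=\exp(Q^{\rm RB}t)$. A Markov jump process $X_t$ with generator $Q=[q_{ij}]$, $q_i=-q_{ii}>0$, is realized by a pair process $(Z_k,T_k)_{k\ge0}$: $Z_k$ is a discrete-time Markov chain on $\mathcal V$ with transition probabilities $q_{ij}/q_i$ ($i\ne j$); given the chain $(Z_k)$, the holding times $T_k$ are independent and exponentially distributed with density $q_{Z_k}e^{-q_{Z_k}t}$; with $t_0=0$, $t_{k+1}=\sum_{l=0}^kT_l$, one sets $X_t=Z_k$ for $t_k\le t<t_{k+1}$. Making exactly $N$ jumps during $[0,t_f]$ means $t_N\le t_f<t_{N+1}$, and the successive nodes occupied are then $Z_0,\dots,Z_N$. *)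

theory Defs
  imports
    "HOL-Probability.Probability"
    "Graph_Theory.Graph_Theory"
    "Jordan_Normal_Form.Spectral_Radius"
begin

text \<open>
  Nodes are the indices \<open>0, \<dots>, n - 1\<close> of the matrices, so a digraph on \<open>n\<close> nodes has
  \<open>pverts G = {0..<n}\<close>.
\<close>

definition adjacency_mat :: "nat \<Rightarrow> nat pair_pre_digraph \<Rightarrow> real mat" where
  "adjacency_mat n G = Matrix.mat n n (\<lambda>(i, j). if (i, j) \<in> parcs G then 1 else 0)"

definition fp_eigenvalue :: "real mat \<Rightarrow> real" where
  "fp_eigenvalue A = spectral_radius (map_mat complex_of_real A)"

definition rb_generator :: "nat \<Rightarrow> nat pair_pre_digraph \<Rightarrow> real Matrix.vec \<Rightarrow> real mat" where
  "rb_generator n G \<phi> =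
     mat_diag n (\<lambda>i. inverse (vec_index \<phi> i)) * adjacency_mat n G * mat_diag n (vec_index \<phi>)
       - fp_eigenvalue (adjacency_mat n G) \<cdot>\<^sub>m 1\<^sub>m n"

definition mat_exp :: "real mat \<Rightarrow> real mat" where
  "mat_exp B = Matrix.mat (dim_row B) (dim_row B) (\<lambda>(i, j). \<Sum>k. (B ^\<^sub>m k) $$ (i, j) / fact k)"

text \<open>
  Right-continuous and piecewise constant on \<open>[0, \<infinity>)\<close>, with finitely many pieces on every
  bounded interval. Values at negative times are irrelevant.
\<close>

definition rc_step_path :: "(real \<Rightarrow> 'a) \<Rightarrow> bool" where
  "rc_step_path x \<longleftrightarrow>
     (\<forall>b>0. \<exists>(m::nat) s. s 0 = 0 \<and> s m = b \<and>
        (\<forall>k<m. s k < s (Suc k) \<and> (\<forall>t\<in>{s k..<s (Suc k)}. x t = x (s k))))"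

text \<open>
  The initial distribution is arbitrary. The last condition is the Markov property for the
  transition matrices \<open>exp (t Q)\<close>: \<open>s\<close> is the present time, \<open>I\<close> a finite set of past times and
  \<open>f\<close> the states occupied at these times.
\<close>

definition markov_jump_process ::
    "'w measure \<Rightarrow> nat \<Rightarrow> real mat \<Rightarrow> (real \<Rightarrow> 'w \<Rightarrow> nat) \<Rightarrow> bool" where
  "markov_jump_process M n Q X \<longleftrightarrow>
     prob_space M \<and>
     (\<forall>t\<ge>0. X t \<in> M \<rightarrow>\<^sub>M count_space {0..<n}) \<and>
     (\<forall>\<omega>\<in>space M. rc_step_path (\<lambda>t. X t \<omega>)) \<and>
     (\<forall>s\<ge>0. \<forall>t\<ge>0. \<forall>I f. \<forall>x<n. \<forall>y<n.
        finite I \<and> I \<subseteq> {0..<s} \<and>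
        \<P>(\<omega> in M. X s \<omega> = x \<and> (\<forall>r\<in>I. X r \<omega> = f r)) > 0 \<longrightarrow>
        \<P>(\<omega> in M. X (s + t) \<omega> = y \<bar> X s \<omega> = x \<and> (\<forall>r\<in>I. X r \<omega> = f r))
          = mat_exp (t \<cdot>\<^sub>m Q) $$ (x, y))"

text \<open>
  Times of the successive jumps of a path, beginning with time \<open>0\<close>; the value is \<open>\<infinity> = Inf {}\<close>
  once there are no further jumps. The value of \<open>jump_chain x k\<close> is meaningful only if
  \<open>jump_time x k < \<infinity>\<close>.
\<close>

primrec jump_time :: "(real \<Rightarrow> 'a) \<Rightarrow> nat \<Rightarrow> ereal" where
  "jump_time x 0 = 0"
| "jump_time x (Suc k) =
     Inf {ereal t | t. jump_time x k < ereal t \<and> x t \<noteq> x (real_of_ereal (jump_time x k))}"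

definition jump_chain :: "(real \<Rightarrow> 'a) \<Rightarrow> nat \<Rightarrow> 'a" where
  "jump_chain x k = x (real_of_ereal (jump_time x k))"

definition exactly_jumps :: "nat \<Rightarrow> real \<Rightarrow> (real \<Rightarrow> 'a) \<Rightarrow> bool" where
  "exactly_jumps N tf x \<longleftrightarrow> jump_time x N \<le> ereal tf \<and> ereal tf < jump_time x (Suc N)"

text \<open>An \<open>N\<close>-step path is the list of its \<open>N + 1\<close> nodes.\<close>

definition step_path_between ::
    "nat pair_pre_digraph \<Rightarrow> nat \<Rightarrow> nat \<Rightarrow> nat \<Rightarrow> nat list \<Rightarrow> bool" where
  "step_path_between G N i j v \<longleftrightarrow>
     length v = Suc N \<and> v ! 0 = i \<and> v ! N = j \<and> (\<forall>k<N. (v ! k, v ! Suc k) \<in> parcs G)"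

definition path_prob ::
    "'w measure \<Rightarrow> (real \<Rightarrow> 'w \<Rightarrow> nat) \<Rightarrow> real \<Rightarrow> nat \<Rightarrow> nat list \<Rightarrow> real" where
  "path_prob M X tf N v =
     \<P>(\<omega> in M. exactly_jumps N tf (\<lambda>t. X t \<omega>) \<and>
               (\<forall>k\<le>N. jump_chain (\<lambda>t. X t \<omega>) k = v ! k))"

end

theory Submission
  imports Defs "HOL-Real_Asymp.Real_Asymp"
begin

text \<open>
  Sample the process at the times \<open>k h\<close> with \<open>h = t\<^sub>f / K\<close>. A sample path has finitely many pieces,
  so for all large \<open>K\<close> the sampled sequence with repetitions removed is exactly the sequence of
  states occupied during \<open>[0, t\<^sub>f]\<close>; by dominated convergence the path probability is the limit of
  the probabilities that the reduced sample equals \<open>v\<close>. Since \<open>exp (h Q) = I + h Q + O(h\<^sup>2)\<close> and all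
  diagonal entries of \<open>Q\<close> are \<open>- \<lambda>\<close>, these are approximately
  \<open>P(X\<^sub>0 = i) (K choose N) (1 - \<lambda> h)\<^bsup>K - N\<^esup> h\<^sup>N \<Prod> q(v\<^sub>l, v\<^sub>l\<^sub>+\<^sub>1)\<close>. The off-diagonal entries along arcs
  are \<open>\<phi>\<^sub>y / \<phi>\<^sub>x\<close>, so the product telescopes to \<open>\<phi>\<^sub>j / \<phi>\<^sub>i\<close> and the limit depends on \<open>v\<close> only through
  its end points and its length.
\<close>

section \<open>Sampling a step path on a fine grid\<close>

text \<open>No jump is demanded at \<open>u (Suc N)\<close>: it only marks a point up to which the
  last state is kept. This lets a path be described on a bounded window without knowing its later
  behaviour.\<close>

definition step_partition :: "(real \<Rightarrow> 'a) \<Rightarrow> nat \<Rightarrow> (nat \<Rightarrow> real) \<Rightarrow> bool" where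
  "step_partition x N u \<longleftrightarrow> u 0 = 0 \<and>
     (\<forall>k\<le>N. u k < u (Suc k) \<and> (\<forall>t\<in>{u k..<u (Suc k)}. x t = x (u k))) \<and>
     (\<forall>k<N. x (u k) \<noteq> x (u (Suc k)))"

lemma step_partitionD:
  assumes "step_partition x N u"
  shows step_partition_zero: "u 0 = 0"
    and step_partition_less: "k \<le> N \<Longrightarrow> u k < u (Suc k)"
    and step_partition_const: "k \<le> N \<Longrightarrow> t \<in> {u k..<u (Suc k)} \<Longrightarrow> x t = x (u k)"
    and step_partition_jump: "k < N \<Longrightarrow> x (u k) \<noteq> x (u (Suc k))"
  using assms unfolding step_partition_def by blast+

definition grid :: "(real \<Rightarrow> 'a) \<Rightarrow> real \<Rightarrow> nat \<Rightarrow> 'a list" where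
  "grid x h K = map (\<lambda>k. x (h * real k)) [0..<Suc K]"

lemma grid_eq_iff:
  "grid x h K = ys \<longleftrightarrow> length ys = Suc K \<and> (\<forall>k\<le>K. x (h * real k) = ys ! k)"
  by (auto simp: grid_def list_eq_iff_nth_eq less_Suc_eq_le simp del: upt_Suc)

lemma grid_Suc: "grid x h (Suc K) = grid x h K @ [x (h * real (Suc K))]"
  by (simp add: grid_def)

lemma remdups_adj_snoc:
  assumes "xs \<noteq> []"
  shows "remdups_adj (xs @ [y]) =
    (if y = last xs then remdups_adj xs else remdups_adj xs @ [y])"
  using assms by (cases xs rule: rev_cases) (simp_all add: remdups_adj_append_two)

text \<open>Removing repetitions preserves the last entry. So the reduced sample determines the
  present state, which is all that the Markov property asks of the past.\<close>

lemma last_if_remdups_adj_eq_take: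
  "remdups_adj ys = take (Suc l) v \<Longrightarrow> l < length v \<Longrightarrow> last ys = v ! l"
  by (metis last_remdups_adj last_snoc take_Suc_conv_app_nth)

text \<open>Neighbouring pieces of an \<open>rc_step_path\<close> may carry the same state. Merging
  such neighbours leaves only division points at which the state really changes.\<close>

lemma rc_step_path_partition:
  assumes "rc_step_path x" "b > 0"
  obtains N u where "step_partition x N u" "u N \<le> b" "b < u (Suc N)"
proof -
  \<comment> \<open>The pieces are taken up to \<open>b + 1\<close> so that \<open>b\<close> lies
    strictly before the end of some piece.\<close>
  have "\<exists>m s. s 0 = 0 \<and> s m = b + 1 \<and>
      (\<forall>k<m. s k < s (Suc k) \<and> (\<forall>t\<in>{s k..<s (Suc k)}. x t = x (s k)))"
    using assms by (simp add: rc_step_path_def)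
  then obtain m s where s0: "s 0 = 0 \<and> s m = b + 1 \<and>
      (\<forall>k<m. s k < s (Suc k) \<and> (\<forall>t\<in>{s k..<s (Suc k)}. x t = x (s k)))"
    by (elim exE)
  then have s: "s 0 = 0" "s m = b + 1"
    "\<And>k. k < m \<Longrightarrow> s k < s (Suc k)"
    "\<And>k t. k < m \<Longrightarrow> t \<in> {s k..<s (Suc k)} \<Longrightarrow> x t = x (s k)"
    by blast+
  \<comment> \<open>The bound \<open>u N \<le> s k\<close> says that the last merged piece contains
    the whole of the last original one. It later yields \<open>u N \<le> b\<close>.\<close>
  have merge: "\<exists>N u. step_partition x N u \<and> u (Suc N) = s (Suc k) \<and> u N \<le> s k" if "k < m" for k
    using that
  proof (induction k)
    case 0
    have "step_partition x 0 s"
      unfolding step_partition_def using s(1) s(3,4)[OF 0] by blast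
    then show ?case by (intro exI[of _ "0::nat"] exI[of _ s]) auto
  next
    case (Suc k)
    then obtain N u where u: "step_partition x N u" "u (Suc N) = s (Suc k)" "u N \<le> s k"
      by auto
    have lt: "s k < s (Suc k)" "s (Suc k) < s (Suc (Suc k))"
      using s(3) Suc.prems by auto
    show ?case
    \<comment> \<open>If the state is unchanged, the last merged piece is prolonged to
      \<open>s (Suc (Suc k))\<close>; otherwise a new piece starts at \<open>s (Suc k)\<close>,
      where a genuine jump occurs.\<close>
    proof (cases "x (s (Suc k)) = x (u N)")
      case True
      let ?u = "u(Suc N := s (Suc (Suc k)))"
      have "step_partition x N ?u"
        unfolding step_partition_def
      proof (intro conjI allI impI ballI)
        show "?u 0 = 0" using step_partition_zero[OF u(1)] by simp
      next
        fix l assume "l \<le> N"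
        then show "?u l < ?u (Suc l)"
          using step_partition_less[OF u(1), of l] u(2,3) lt by (cases "l = N") auto
      next
        fix l t assume l: "l \<le> N" and t: "t \<in> {?u l..<?u (Suc l)}"
        show "x t = x (?u l)"
        proof (cases "l = N \<and> t \<ge> s (Suc k)")
          case c: True
          then have "x t = x (s (Suc k))" using t by (intro s(4)[OF Suc.prems]) simp
          then show ?thesis using c True by simp
        next
          case False
          then have "t \<in> {u l..<u (Suc l)}" using t l u(2) by (cases "l = N") auto
          from step_partition_const[OF u(1) l this] show ?thesis using l by simp
        qed
      next
        fix l assume "l < N"
        then show "x (?u l) \<noteq> x (?u (Suc l))" using step_partition_jump[OF u(1), of l] by simp
      qed
      moreover have "?u (Suc N) = s (Suc (Suc k))" "?u N \<le> s (Suc k)"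
        using u lt by auto
      ultimately show ?thesis by blast
    next
      case False
      let ?u = "u(Suc (Suc N) := s (Suc (Suc k)))"
      have "step_partition x (Suc N) ?u"
        unfolding step_partition_def
      proof (intro conjI allI impI ballI)
        show "?u 0 = 0" using step_partition_zero[OF u(1)] by simp
      next
        fix l assume "l \<le> Suc N"
        then show "?u l < ?u (Suc l)"
          using step_partition_less[OF u(1), of l] u(2) lt by (cases "l = Suc N") auto
      next
        fix l t assume l: "l \<le> Suc N" and t: "t \<in> {?u l..<?u (Suc l)}"
        show "x t = x (?u l)"
        proof (cases "l = Suc N")
          case c: True
          then have "x t = x (s (Suc k))" using t u(2) by (intro s(4)[OF Suc.prems]) simp
          then show ?thesis using c u(2) by simp
        next
          case False
          with l t have "l \<le> N" "t \<in> {u l..<u (Suc l)}" by auto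
          from step_partition_const[OF u(1) this] show ?thesis using l False by simp
        qed
      next
        fix l assume "l < Suc N"
        then show "x (?u l) \<noteq> x (?u (Suc l))"
          using step_partition_jump[OF u(1), of l] u(2) False by (cases "l = N") auto
      qed
      moreover have "?u (Suc (Suc N)) = s (Suc (Suc k))" "?u (Suc N) \<le> s (Suc k)"
        using u by auto
      ultimately show ?thesis by blast
    qed
  qed
  \<comment> \<open>The original piece with index \<open>k\<close> is the one that contains
    \<open>b\<close>.\<close>
  define k where "k = Max {k. k \<le> m \<and> s k \<le> b}"
  have fin: "finite {k. k \<le> m \<and> s k \<le> b}" by simp
  have "0 \<in> {k. k \<le> m \<and> s k \<le> b}" using s(1) assms by auto
  then have k: "k \<le> m" "s k \<le> b" using Max_in[OF fin] unfolding k_def[symmetric] by blast+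
  with s(2) have km: "k < m" by (cases "k = m") auto
  have "\<not> s (Suc k) \<le> b"
    using Max_ge[OF fin, of "Suc k"] km unfolding k_def[symmetric] by auto
  moreover obtain N u where "step_partition x N u" "u (Suc N) = s (Suc k)" "u N \<le> s k"
    using merge[OF km] by blast
  ultimately show ?thesis using k(2) that[of N u] by simp
qed

section \<open>Jump times and jump chain of a partitioned path\<close>

lemma step_partition_jump_time_ge:
  assumes "step_partition x N u" "k \<le> N" "jump_time x k = ereal (u k)"
  shows "ereal (u (Suc k)) \<le> jump_time x (Suc k)"
proof -
  \<comment> \<open>No time before \<open>u (Suc k)\<close> enters the infimum that defines the next
    jump time. For \<open>k = N\<close> this is all that can be said, as the path need not jump at
    \<open>u (Suc N)\<close>.\<close>
  have "u (Suc k) \<le> t" if "u k < t" "x t \<noteq> x (u k)" for t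
    using step_partition_const[OF assms(1,2), of t] that by force
  then show ?thesis using assms by (auto intro!: Inf_greatest)
qed

text \<open>For \<open>k < N\<close> the infimum is attained: the path already has its new state at
  the time \<open>u (Suc k)\<close> itself.\<close>

lemma step_partition_jump_time:
  assumes "step_partition x N u" "k \<le> N"
  shows "jump_time x k = ereal (u k)"
  using assms(2)
proof (induction k)
  case 0
  then show ?case using step_partition_zero[OF assms(1)] by (simp add: zero_ereal_def)
next
  case (Suc k)
  then have IH: "jump_time x k = ereal (u k)" by simp
  have "jump_time x (Suc k) \<le> ereal (u (Suc k))"
    using step_partition_less[OF assms(1), of k] step_partition_jump[OF assms(1), of k] IH Suc.prems
    by (auto intro!: Inf_lower)
  moreover have "ereal (u (Suc k)) \<le> jump_time x (Suc k)"
    using step_partition_jump_time_ge[OF assms(1) _ IH] Suc.prems by simp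
  ultimately show ?case by (rule antisym)
qed

lemma step_partition_jump_chain:
  "step_partition x N u \<Longrightarrow> k \<le> N \<Longrightarrow> jump_chain x k = x (u k)"
  by (simp add: jump_chain_def step_partition_jump_time)

lemma step_partition_exactly_jumps:
  assumes "step_partition x N u" "u N \<le> b" "b < u (Suc N)"
  shows "exactly_jumps N b x"
  using step_partition_jump_time_ge[OF assms(1) order.refl step_partition_jump_time[OF assms(1) order.refl]]
    step_partition_jump_time[OF assms(1) order.refl] assms
  unfolding exactly_jumps_def by (metis ereal_less_eq(3) less_ereal.simps(1) order_less_le_trans)

lemma jump_time_mono: "mono (jump_time x)"
proof (rule incseq_SucI)
  show "jump_time x k \<le> jump_time x (Suc k)" for k
    by (auto intro!: Inf_greatest)
qed

text \<open>Jump times increase weakly, so \<open>N < N'\<close> would give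
  \<open>jump_time x (Suc N) \<le> jump_time x N' \<le> b\<close>, against
  \<open>b < jump_time x (Suc N)\<close>.\<close>

lemma exactly_jumps_unique:
  assumes "exactly_jumps N b x" "exactly_jumps N' b x"
  shows "N = N'"
proof -
  have "\<not> N < N'" if "exactly_jumps N b x" "exactly_jumps N' b x" for N N'
    using that monoD[OF jump_time_mono, of "Suc N" N' x] unfolding exactly_jumps_def
    by (metis Suc_leI leD order_trans)
  then show ?thesis using assms by (metis linorder_neqE_nat)
qed

text \<open>A mesh finer than every piece cannot step over a piece: consecutive samples lie in the
  same piece or in adjacent ones. Hence the samples miss no state, and the reduced list grows
  exactly when a division point is crossed.\<close>

lemma step_partition_remdups_adj_grid:
  assumes u: "step_partition x N u" and h: "h > 0" "\<And>l. l \<le> N \<Longrightarrow> h < u (Suc l) - u l"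
    and l: "l \<le> N" "h * real k \<in> {u l..<u (Suc l)}"
  shows "remdups_adj (grid x h k) = map (\<lambda>l. x (u l)) [0..<Suc l]"
  using l
proof (induction k arbitrary: l)
  case 0
  have "0 < u (Suc k)" if "k \<le> N" for k
    using that
  proof (induction k)
    case 0
    then show ?case using step_partition_zero[OF u] step_partition_less[OF u, of 0] by simp
  next
    case (Suc k)
    then show ?case using step_partition_less[OF u, of "Suc k"] by simp
  qed
  with 0 have "l = 0" by (cases l) (auto simp: not_le[symmetric])
  then show ?case using step_partition_zero[OF u] by (simp add: grid_def)
next
  case (Suc k)
  have t': "h * real (Suc k) = h * real k + h" by (simp add: algebra_simps)
  have const: "x t = x (u l)" if "l \<le> N" "t \<in> {u l..<u (Suc l)}" for l t
    using that by (rule step_partition_const[OF u])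
  have last: "last (grid x h k) = x (h * real k)" and ne: "grid x h k \<noteq> []"
    by (auto simp: grid_def)
  show ?case
  proof (cases "h * real k \<ge> u l")
    case True
    then have "h * real k \<in> {u l..<u (Suc l)}" using Suc.prems h(1) t' by auto
    then show ?thesis
      using Suc.IH[of l] Suc.prems const[of l "h * real k"] const[of l "h * real (Suc k)"] last ne
      by (simp add: grid_Suc remdups_adj_snoc del: of_nat_Suc upt_Suc)
  next
    \<comment> \<open>A division point was crossed. Since \<open>h\<close> is shorter than the piece
      before \<open>u l\<close>, the previous sample lies in that piece.\<close>
    case False
    have "l \<noteq> 0"
    proof
      assume "l = 0"
      then have "u l = 0" using step_partition_zero[OF u] by simp
      then show False using False h(1) by simp
    qed
    then obtain l' where l': "l = Suc l'" by (cases l) auto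
    have "h * real k \<in> {u l'..<u (Suc l')}"
      using False h(2)[of l'] Suc.prems t' l' by auto
    moreover have "x (u l') \<noteq> x (u l)" using step_partition_jump[OF u, of l'] Suc.prems l' by simp
    ultimately show ?thesis
      using Suc.IH[of l'] Suc.prems const[of l "h * real (Suc k)"] const[of l' "h * real k"] last ne l'
      by (simp add: grid_Suc remdups_adj_snoc del: of_nat_Suc)
  qed
qed

text \<open>The threshold for \<open>K\<close> depends on the path through its shortest piece. This
  is pointwise convergence of events, which is enough for dominated convergence.\<close>

lemma eventually_grid_iff_jumps:
  assumes x: "rc_step_path x" and "b > 0" and v: "length v = Suc N"
  shows "eventually (\<lambda>K. remdups_adj (grid x (b / real K) K) = v \<longleftrightarrow>
           exactly_jumps N b x \<and> (\<forall>k\<le>N. jump_chain x k = v ! k)) sequentially"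
proof -
  obtain N' u where u: "step_partition x N' u" "u N' \<le> b" "b < u (Suc N')"
    using rc_step_path_partition[OF x \<open>b > 0\<close>] .
  define g where "g = Min ((\<lambda>l. u (Suc l) - u l) ` {..N'})"
  have "g > 0" using step_partition_less[OF u(1)] by (auto simp: g_def)
  have g: "g \<le> u (Suc l) - u l" if "l \<le> N'" for l
    using that unfolding g_def by (intro Min_le) auto
  have "eventually (\<lambda>K. b / real K < g) sequentially"
    using \<open>g > 0\<close> by (intro order_tendstoD(2)[OF lim_const_over_n]) 
  then show ?thesis
    using eventually_gt_at_top[of 0]
  proof eventually_elim
    case (elim K)
    have "remdups_adj (grid x (b / real K) K) = map (\<lambda>l. x (u l)) [0..<Suc N']"
      using u elim \<open>b > 0\<close> g by (intro step_partition_remdups_adj_grid) (auto intro: less_le_trans)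
    moreover have "exactly_jumps N b x \<longleftrightarrow> N = N'"
      using exactly_jumps_unique step_partition_exactly_jumps[OF u] by blast
    moreover have "(map (\<lambda>l. x (u l)) [0..<Suc N] = v) \<longleftrightarrow> (\<forall>k\<le>N. x (u k) = v ! k)"
      using v by (auto simp: list_eq_iff_nth_eq less_Suc_eq_le simp del: upt_Suc)
    \<comment> \<open>If the true number of jumps is not \<open>N\<close>, both sides of the
      equivalence are false, the left one because the lengths differ.\<close>
    moreover have "map (\<lambda>l. x (u l)) [0..<Suc N'] \<noteq> v" if "N \<noteq> N'"
      using v that by (auto dest!: arg_cong[of _ _ length])
    ultimately show ?case using step_partition_jump_chain[OF u(1)] by (cases "N = N'") auto
  qed
qed

section \<open>Asymptotics\<close>

text \<open>The total weight of all ways to place \<open>l\<close> jumps among \<open>K\<close>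
  steps, with factor \<open>d\<close> for a step at rest and \<open>c k\<close> for the jump out of
  position \<open>k\<close>. The truncated \<open>K - l\<close> is harmless because the binomial
  coefficient vanishes for \<open>l > K\<close>.\<close>

definition binomial_weight :: "real \<Rightarrow> (nat \<Rightarrow> real) \<Rightarrow> nat \<Rightarrow> nat \<Rightarrow> real" where
  "binomial_weight d c K l = real (K choose l) * d ^ (K - l) * (\<Prod>k<l. c k)"

lemma binomial_weight_simps:
  shows "binomial_weight d c 0 0 = 1" "binomial_weight d c 0 (Suc l) = 0"
    and "binomial_weight d c (Suc K) 0 = binomial_weight d c K 0 * d"
  by (simp_all add: binomial_weight_def)

text \<open>Pascal's rule, sorted by whether the last step is at rest or is the jump out of position
  \<open>l\<close>.\<close>

lemma binomial_weight_Suc_Suc: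
  "binomial_weight d c (Suc K) (Suc l) =
     binomial_weight d c K (Suc l) * d + binomial_weight d c K l * c l"
proof -
  have "real (K choose Suc l) * d ^ (K - l) = real (K choose Suc l) * (d ^ (K - Suc l) * d)"
  proof (cases "l < K")
    case True
    then have "K - l = Suc (K - Suc l)" by simp
    then show ?thesis by simp
  next
    case False
    then show ?thesis by (simp add: binomial_eq_0)
  qed
  then show ?thesis by (simp add: binomial_weight_def algebra_simps)
qed

lemma binomial_weight_nonneg:
  assumes "0 \<le> d" "\<And>k. k < l \<Longrightarrow> 0 \<le> c k"
  shows "0 \<le> binomial_weight d c K l"
  using assms by (auto simp: binomial_weight_def intro!: mult_nonneg_nonneg prod_nonneg)

text \<open>Allows the position-dependent factors of the sampled process to be replaced by bounds
  for which the recursion has a closed solution. All factors and \<open>f\<close> are nonnegative,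
  and \<open>g\<close> inherits this from \<open>f \<le> g\<close> during the induction.\<close>

lemma pascal_recursion_mono:
  fixes f g :: "nat \<Rightarrow> nat \<Rightarrow> real"
  assumes f: "\<And>K. f (Suc K) 0 = f K 0 * d 0"
      "\<And>K l. l < N \<Longrightarrow> f (Suc K) (Suc l) = f K (Suc l) * d (Suc l) + f K l * c l"
    and g: "\<And>K. g (Suc K) 0 = g K 0 * d' 0"
      "\<And>K l. l < N \<Longrightarrow> g (Suc K) (Suc l) = g K (Suc l) * d' (Suc l) + g K l * c' l"
    and d: "\<And>l. l \<le> N \<Longrightarrow> 0 \<le> d l \<and> d l \<le> d' l"
    and c: "\<And>l. l < N \<Longrightarrow> 0 \<le> c l \<and> c l \<le> c' l"
    and init: "\<And>l. l \<le> N \<Longrightarrow> f 0 l \<le> g 0 l"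
    and pos: "\<And>K l. l \<le> N \<Longrightarrow> 0 \<le> f K l"
    and "l \<le> N"
  shows "f K l \<le> g K l"
  using \<open>l \<le> N\<close>
proof (induction K arbitrary: l)
  case 0
  then show ?case by (rule init)
next
  case (Suc K)
  have *: "f K l * a \<le> g K l * b" if "l \<le> N" "0 \<le> a" "a \<le> b" for l a b
  proof (rule mult_mono)
    show "f K l \<le> g K l" by (rule Suc.IH[OF that(1)])
    then show "0 \<le> g K l" using pos[OF that(1), of K] by linarith
  qed (use that in auto)
  show ?case
  proof (cases l)
    case 0
    then show ?thesis using *[of 0] d[of 0] by (simp add: f(1) g(1))
  next
    case (Suc l')
    with Suc.prems have "l' < N" by simp
    then show ?thesis
      using *[of "Suc l'"] *[of l'] d[of "Suc l'"] c[of l'] by (auto simp: Suc f(2) g(2) intro!: add_mono)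
  qed
qed

lemma tendsto_choose_over_power: "(\<lambda>K. real (K choose N) / real K ^ N) \<longlonglongrightarrow> 1 / fact N"
proof (induction N)
  case 0
  then show ?case by simp
next
  case (Suc N)
  \<comment> \<open>This is the quotient of the terms for \<open>Suc N\<close> and
    \<open>N\<close>.\<close>
  have *: "(\<lambda>K::nat. (real K - real N) / (real (Suc N) * real K)) \<longlonglongrightarrow> 1 / real (Suc N)"
    by (real_asymp simp: field_simps)
  have "(\<lambda>K. real (K choose N) / real K ^ N * ((real K - real N) / (real (Suc N) * real K)))
          \<longlonglongrightarrow> 1 / fact N * (1 / real (Suc N))"
    by (intro tendsto_mult Suc *)
  moreover have "real (K choose N) / real K ^ N * ((real K - real N) / (real (Suc N) * real K))
      = real (K choose Suc N) / real K ^ Suc N" for K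
  proof (cases "N \<le> K")
    case True
    have "Suc N * (K choose Suc N) = (K choose N) * (K - N)"
      by (metis binomial_absorb_comp binomial_absorption mult.commute)
    then have "real (Suc N) * real (K choose Suc N) = real (K choose N) * (real K - real N)"
      by (metis True of_nat_diff of_nat_mult)
    then show ?thesis by (cases "K = 0") (simp_all add: divide_simps mult.commute del: of_nat_Suc)
  next
    case False
    then show ?thesis by (simp add: binomial_eq_0)
  qed
  ultimately show ?case by (simp add: field_simps)
qed

text \<open>With base \<open>1 + u K\<close>, the logarithm of the power is \<open>K * u K\<close>
  up to an error of order \<open>K * (u K)^2\<close>. The former tends to \<open>- a * b\<close>,
  and the latter is the bounded \<open>K * u K\<close> times the null sequence
  \<open>u K\<close>.\<close>

lemma tendsto_perturbed_exp_limit: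
  fixes a b e :: real
  shows "(\<lambda>K::nat. (1 - a * (b / real K) + e * (b / real K)\<^sup>2) ^ K) \<longlonglongrightarrow> exp (- a * b)"
proof -
  define u where "u K = - a * (b / real K) + e * (b / real K)\<^sup>2" for K
  have "(\<lambda>K. - a * (b / real K) + e * (b / real K)\<^sup>2) \<longlonglongrightarrow> - a * 0 + e * 0\<^sup>2"
    by (intro tendsto_intros lim_const_over_n)
  then have u0: "u \<longlonglongrightarrow> 0" by (simp add: u_def[abs_def])
  have "(\<lambda>K. - a * b + e * b * (b / real K)) \<longlonglongrightarrow> - a * b + e * b * 0"
    by (intro tendsto_intros lim_const_over_n)
  moreover have "eventually (\<lambda>K. - a * b + e * b * (b / real K) = real K * u K) sequentially"
    using eventually_gt_at_top[of 0]
    by eventually_elim (simp add: u_def power2_eq_square field_simps)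
  ultimately have Ku: "(\<lambda>K. real K * u K) \<longlonglongrightarrow> - a * b"
    by (simp add: filterlim_cong)
  \<comment> \<open>The range in which \<open>ln (1 + u)\<close> is within \<open>2 * u^2\<close> of
    \<open>u\<close>; it also makes \<open>1 + u K\<close> positive, so that \<open>exp\<close>
    undoes \<open>ln\<close>.\<close>
  have ev: "eventually (\<lambda>K. \<bar>u K\<bar> < 1 / 2) sequentially"
    using tendsto_rabs[OF u0] by (intro order_tendstoD(2)[of _ 0]) auto
  have "(\<lambda>K. real K * ln (1 + u K) - real K * u K) \<longlonglongrightarrow> 0"
  proof (rule Lim_null_comparison)
    show "eventually (\<lambda>K. norm (real K * ln (1 + u K) - real K * u K)
            \<le> 2 * \<bar>real K * u K\<bar> * \<bar>u K\<bar>) sequentially"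
      using ev
    proof eventually_elim
      case (elim K)
      have "\<bar>ln (1 + u K) - u K\<bar> \<le> 2 * (u K)\<^sup>2"
        using elim by (intro abs_ln_one_plus_x_minus_x_bound) auto
      then have "real K * \<bar>ln (1 + u K) - u K\<bar> \<le> real K * (2 * (u K)\<^sup>2)"
        by (intro mult_left_mono) auto
      moreover have "norm (real K * ln (1 + u K) - real K * u K) = real K * \<bar>ln (1 + u K) - u K\<bar>"
        by (simp add: right_diff_distrib[symmetric] abs_mult del: right_diff_distrib)
      moreover have "(u K)\<^sup>2 = \<bar>u K\<bar> * \<bar>u K\<bar>"
        by (simp add: power2_eq_square)
      ultimately show ?case by (simp add: abs_mult mult_ac)
    qed
    have "(\<lambda>K. 2 * \<bar>real K * u K\<bar> * \<bar>u K\<bar>) \<longlonglongrightarrow> 2 * \<bar>- a * b\<bar> * \<bar>0\<bar>"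
      by (intro tendsto_intros Ku u0)
    then show "(\<lambda>K. 2 * \<bar>real K * u K\<bar> * \<bar>u K\<bar>) \<longlonglongrightarrow> 0" by simp
  qed
  from tendsto_add[OF this Ku] have "(\<lambda>K. exp (real K * ln (1 + u K))) \<longlonglongrightarrow> exp (- a * b)"
    by (intro tendsto_exp) simp
  moreover have "eventually (\<lambda>K. exp (real K * ln (1 + u K)) =
      (1 - a * (b / real K) + e * (b / real K)\<^sup>2) ^ K) sequentially"
    using ev proof eventually_elim
    case (elim K)
    then have "exp (real K * ln (1 + u K)) = (1 + u K) ^ K"
      by (subst exp_of_nat_mult) auto
    then show ?case by (simp add: u_def algebra_simps)
  qed
  ultimately show ?thesis
    by (simp add: filterlim_cong)
qed

text \<open>Taking \<open>b / real K\<close> out of each of the \<open>N\<close> jump factors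
  supplies \<open>b ^ N\<close> and the divisor \<open>K ^ N\<close> of the binomial coefficient.
  The exponent \<open>K - N\<close> behaves like \<open>K\<close>, since a fixed power of a base
  tending to 1 tends to 1. The quadratic perturbation \<open>e\<close> leaves no trace in the
  limit.\<close>

lemma tendsto_perturbed_binomial_weight:
  fixes c :: "nat \<Rightarrow> real"
  shows "(\<lambda>K. binomial_weight (1 - a * (b / real K) + e * (b / real K)\<^sup>2)
            (\<lambda>l. c l * (b / real K) + e * (b / real K)\<^sup>2) K N)
         \<longlonglongrightarrow> b ^ N / fact N * exp (- a * b) * (\<Prod>l<N. c l)"
proof -
  have "(\<lambda>K. 1 - a * (b / real K) + e * (b / real K)\<^sup>2) \<longlonglongrightarrow> 1 - a * 0 + e * 0\<^sup>2"
    by (intro tendsto_intros lim_const_over_n)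
  then have 1: "(\<lambda>K. 1 - a * (b / real K) + e * (b / real K)\<^sup>2) \<longlonglongrightarrow> 1"
    by simp
  have "(\<lambda>K. c l + e * (b / real K)) \<longlonglongrightarrow> c l + e * 0" for l
    by (intro tendsto_intros lim_const_over_n)
  then have 2: "(\<lambda>K. c l + e * (b / real K)) \<longlonglongrightarrow> c l" for l
    by simp
  have "(\<lambda>K. b ^ N * (real (K choose N) / real K ^ N) *
           ((1 - a * (b / real K) + e * (b / real K)\<^sup>2) ^ K / (1 - a * (b / real K) + e * (b / real K)\<^sup>2) ^ N) *
           (\<Prod>l<N. c l + e * (b / real K)))
        \<longlonglongrightarrow> b ^ N * (1 / fact N) * (exp (- a * b) / 1 ^ N) * (\<Prod>l<N. c l)"
    by (intro tendsto_intros tendsto_choose_over_power tendsto_perturbed_exp_limit 1 2) simp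
  moreover have "eventually (\<lambda>K. b ^ N * (real (K choose N) / real K ^ N) *
           ((1 - a * (b / real K) + e * (b / real K)\<^sup>2) ^ K / (1 - a * (b / real K) + e * (b / real K)\<^sup>2) ^ N) *
           (\<Prod>l<N. c l + e * (b / real K)) =
        real (K choose N) * (1 - a * (b / real K) + e * (b / real K)\<^sup>2) ^ (K - N) *
            (\<Prod>l<N. c l * (b / real K) + e * (b / real K)\<^sup>2)) sequentially"
    using order_tendstoD(1)[OF 1, of 0, simplified] eventually_gt_at_top[of N]
  proof eventually_elim
    case (elim K)
    have "(\<Prod>l<N. c l * (b / real K) + e * (b / real K)\<^sup>2) = (\<Prod>l<N. (b / real K) * (c l + e * (b / real K)))"
      by (intro prod.cong) (auto simp: algebra_simps power2_eq_square)
    also have "\<dots> = (b / real K) ^ N * (\<Prod>l<N. c l + e * (b / real K))"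
      by (simp only: prod.distrib prod_constant card_lessThan)
    finally show ?case
      using elim by (simp add: power_diff power_divide mult_ac)
  qed
  ultimately show ?thesis
    by (simp add: filterlim_cong binomial_weight_def)
qed

section \<open>Entrywise estimates for matrix powers and the matrix exponential\<close>

lemma pow_mat_abs_le:
  fixes B :: "real mat"
  assumes B: "B \<in> carrier_mat n n" and b: "\<And>x y. x < n \<Longrightarrow> y < n \<Longrightarrow> \<bar>B $$ (x, y)\<bar> \<le> b"
    and "x < n" "y < n"
  shows "\<bar>(B ^\<^sub>m k) $$ (x, y)\<bar> \<le> (real n * b) ^ k"
  using \<open>x < n\<close> \<open>y < n\<close>
proof (induction k arbitrary: x y)
  case 0
  then show ?case using B by simp
next
  case (Suc k)
  have car: "B ^\<^sub>m k \<in> carrier_mat n n" using B by simp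
  have b0: "0 \<le> b" using b[OF Suc.prems] by linarith
  have "\<bar>(B ^\<^sub>m Suc k) $$ (x, y)\<bar> = \<bar>\<Sum>z<n. (B ^\<^sub>m k) $$ (x, z) * B $$ (z, y)\<bar>"
    using B car Suc.prems by (simp add: scalar_prod_def atLeast0LessThan)
  also have "\<dots> \<le> (\<Sum>z<n. \<bar>(B ^\<^sub>m k) $$ (x, z)\<bar> * \<bar>B $$ (z, y)\<bar>)"
    by (simp add: abs_mult[symmetric])
  also have "\<dots> \<le> (\<Sum>z<n. (real n * b) ^ k * b)"
    using Suc.IH Suc.prems b b0 by (intro sum_mono mult_mono) auto
  also have "\<dots> = (real n * b) ^ Suc k" by simp
  finally show ?case .
qed

text \<open>With \<open>z = n * b\<close> the series from the quadratic term on is dominated by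
  \<open>exp z - 1 - z\<close>, which is at most \<open>z^2\<close> for \<open>z\<close> in the unit
  interval.\<close>

lemma mat_exp_second_order:
  fixes B :: "real mat"
  assumes B: "B \<in> carrier_mat n n" and b: "\<And>x y. x < n \<Longrightarrow> y < n \<Longrightarrow> \<bar>B $$ (x, y)\<bar> \<le> b"
    and xy: "x < n" "y < n" and nb: "real n * b \<le> 1"
  shows "\<bar>mat_exp B $$ (x, y) - (if x = y then 1 else 0) - B $$ (x, y)\<bar> \<le> (real n * b)\<^sup>2"
proof -
  define z where "z = real n * b"
  have z: "0 \<le> z" "z \<le> 1"
    using b[OF xy] nb unfolding z_def by (auto intro!: mult_nonneg_nonneg)
  define f where "f k = (B ^\<^sub>m k) $$ (x, y) / fact k" for k
  have fz: "norm (f k) \<le> z ^ k / fact k" for k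
    using pow_mat_abs_le[OF B b xy, of k] by (simp add: f_def z_def divide_right_mono)
  have exps: "(\<lambda>k. z ^ k / fact k) sums exp z"
    using exp_converges[of z] by (simp add: divide_inverse mult.commute)
  have sf: "summable f"
    using fz by (intro summable_comparison_test'[OF sums_summable[OF exps], of 0]) auto
  have nf: "norm (suminf (\<lambda>k. f (k + 2))) \<le> suminf (\<lambda>k. z ^ (k + 2) / fact (k + 2))"
    by (intro norm_suminf_le fz summable_ignore_initial_segment sums_summable[OF exps])
  have "mat_exp B $$ (x, y) = suminf f"
    using B xy by (simp add: mat_exp_def f_def[abs_def])
  also have "\<dots> = suminf (\<lambda>k. f (k + 2)) + (\<Sum>k<2. f k)"
    by (rule suminf_split_initial_segment[OF sf])
  also have "(\<Sum>k<2. f k) = (if x = y then 1 else 0) + B $$ (x, y)"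
    using B xy by (simp add: numeral_2_eq_2 f_def)
  finally have eq: "mat_exp B $$ (x, y) - (if x = y then 1 else 0) - B $$ (x, y) = suminf (\<lambda>k. f (k + 2))"
    by simp
  have "exp z = suminf (\<lambda>k. z ^ (k + 2) / fact (k + 2)) + (\<Sum>k<2. z ^ k / fact k)"
    using suminf_split_initial_segment[OF sums_summable[OF exps], of 2] sums_unique[OF exps] by simp
  then have "suminf (\<lambda>k. z ^ (k + 2) / fact (k + 2)) = exp z - 1 - z"
    by (simp add: numeral_2_eq_2)
  then show ?thesis using nf exp_bound[OF z] unfolding eq z_def[symmetric] real_norm_def by linarith
qed

section \<open>Path probabilities of a Markov jump process\<close>

locale jump_process =
  fixes M :: "'w measure" and n :: nat and Q :: "real mat" and X :: "real \<Rightarrow> 'w \<Rightarrow> nat"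
  assumes markov_jump_process: "markov_jump_process M n Q X"
begin

sublocale prob_space M
  using markov_jump_process by (simp add: markov_jump_process_def)

lemma X_measurable [measurable]: "0 \<le> t \<Longrightarrow> X t \<in> M \<rightarrow>\<^sub>M count_space UNIV"
proof -
  assume "0 \<le> t"
  then have "X t \<in> M \<rightarrow>\<^sub>M count_space {0..<n}"
    using markov_jump_process by (simp add: markov_jump_process_def)
  from measurable_compose[OF this, of "\<lambda>x. x" "count_space UNIV"] show ?thesis by simp
qed

lemma X_less: "0 \<le> t \<Longrightarrow> \<omega> \<in> space M \<Longrightarrow> X t \<omega> < n"
  using markov_jump_process measurable_space[of "X t" M "count_space {0..<n}" \<omega>]
  by (simp add: markov_jump_process_def)

lemma rc_step_path_X: "\<omega> \<in> space M \<Longrightarrow> rc_step_path (\<lambda>t. X t \<omega>)"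
  using markov_jump_process by (simp add: markov_jump_process_def)

lemma markov_property:
  assumes "0 \<le> s" "0 \<le> t" "I \<subseteq> {0..<s}" "finite I" "x < n" "y < n"
    and "0 < \<P>(\<omega> in M. X s \<omega> = x \<and> (\<forall>r\<in>I. X r \<omega> = f r))"
  shows "\<P>(\<omega> in M. X (s + t) \<omega> = y \<bar> X s \<omega> = x \<and> (\<forall>r\<in>I. X r \<omega> = f r)) =
    mat_exp (t \<cdot>\<^sub>m Q) $$ (x, y)"
  using markov_jump_process assms unfolding markov_jump_process_def by simp

section \<open>Law of the process sampled on a grid\<close>

lemma grid_measurable [measurable]:
  assumes "0 \<le> h"
  shows "(\<lambda>\<omega>. grid (\<lambda>t. X t \<omega>) h K) \<in> M \<rightarrow>\<^sub>M count_space UNIV"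
proof -
  have "(\<lambda>\<omega>. grid (\<lambda>t. X t \<omega>) h K) -` {ys} \<inter> space M \<in> sets M" for ys
  proof -
    have [measurable]: "X (h * real k) \<in> M \<rightarrow>\<^sub>M count_space UNIV" for k
      using assms by simp
    have "(\<lambda>\<omega>. grid (\<lambda>t. X t \<omega>) h K) -` {ys} \<inter> space M =
        {\<omega> \<in> space M. length ys = Suc K \<and> (\<forall>k\<in>{..K}. X (h * real k) \<omega> = ys ! k)}"
      by (simp add: vimage_def Int_def grid_eq_iff conj_commute Ball_def)
    also have "\<dots> \<in> sets M" by measurable
    finally show ?thesis .
  qed
  \<comment> \<open>Lists of natural numbers form a countable type, so preimages of singletons
    suffice.\<close>
  then show ?thesis by (simp add: measurable_count_space_eq2_countable)
qed

text \<open>The Markov property with present time \<open>h * real K\<close> and the earlier grid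
  times as past. A sample list of probability zero is treated separately, because conditioning on it
  says nothing; both sides then vanish.\<close>

lemma prob_grid_snoc:
  assumes h: "0 < h" and ys: "length ys = Suc K" and a: "last ys < n" and y: "y < n"
  shows "\<P>(\<omega> in M. grid (\<lambda>t. X t \<omega>) h K = ys \<and> X (h * real (Suc K)) \<omega> = y) =
    \<P>(\<omega> in M. grid (\<lambda>t. X t \<omega>) h K = ys) * mat_exp (h \<cdot>\<^sub>m Q) $$ (last ys, y)"
proof (cases "\<P>(\<omega> in M. grid (\<lambda>t. X t \<omega>) h K = ys) = 0")
  case True
  have [measurable]: "(\<lambda>\<omega>. grid (\<lambda>t. X t \<omega>) h K) \<in> M \<rightarrow>\<^sub>M count_space UNIV"
    using h by simp
  have "\<P>(\<omega> in M. grid (\<lambda>t. X t \<omega>) h K = ys \<and> X (h * real (Suc K)) \<omega> = y)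
      \<le> \<P>(\<omega> in M. grid (\<lambda>t. X t \<omega>) h K = ys)"
    by (intro finite_measure_mono) auto
  with True have "\<P>(\<omega> in M. grid (\<lambda>t. X t \<omega>) h K = ys \<and> X (h * real (Suc K)) \<omega> = y) = 0"
    by (intro antisym) simp_all
  then show ?thesis unfolding True by simp
next
  case False
  define I where "I = (\<lambda>k. h * real k) ` {..<K}"
  \<comment> \<open>The past states must be a function of time, so the index is recovered from the
    grid time by dividing by \<open>h\<close>.\<close>
  define f where "f r = ys ! nat \<lfloor>r / h\<rfloor>" for r
  have f: "f (h * real k) = ys ! k" for k using h by (simp add: f_def)
  have last: "last ys = ys ! K" using ys by (cases ys rule: rev_cases) auto
  have eq: "grid (\<lambda>t. X t \<omega>) h K = ys \<longleftrightarrow>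
      X (h * real K) \<omega> = last ys \<and> (\<forall>r\<in>I. X r \<omega> = f r)" for \<omega>
    unfolding grid_eq_iff I_def last by (simp add: ys f le_less all_conj_distrib disj_imp) blast
  let ?past = "\<lambda>\<omega>. X (h * real K) \<omega> = last ys \<and> (\<forall>r\<in>I. X r \<omega> = f r)"
  have Suc: "h * real (Suc K) = h * real K + h" by (simp add: algebra_simps)
  have cond: "\<P>(\<omega> in M. X (h * real (Suc K)) \<omega> = y \<bar> ?past \<omega>) = mat_exp (h \<cdot>\<^sub>m Q) $$ (last ys, y)"
    unfolding Suc
  proof (rule markov_property)
    show "I \<subseteq> {0..<h * real K}" "finite I" using h by (auto simp: I_def)
    show "0 < \<P>(\<omega> in M. ?past \<omega>)"
      using False unfolding eq by (simp only: zero_less_measure_iff simp_thms)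
  qed (use h a y in simp_all)
  have "\<P>(\<omega> in M. X (h * real (Suc K)) \<omega> = y \<bar> ?past \<omega>) =
      \<P>(\<omega> in M. ?past \<omega> \<and> X (h * real (Suc K)) \<omega> = y) / \<P>(\<omega> in M. ?past \<omega>)"
    unfolding cond_prob_def by (subst conj_commute) (rule refl)
  then have ratio: "\<P>(\<omega> in M. ?past \<omega> \<and> X (h * real (Suc K)) \<omega> = y) / \<P>(\<omega> in M. ?past \<omega>) =
      mat_exp (h \<cdot>\<^sub>m Q) $$ (last ys, y)"
    using cond by (rule trans[OF sym])
  have "\<P>(\<omega> in M. ?past \<omega>) \<noteq> 0"
    using False unfolding eq .
  from iffD1[OF nonzero_divide_eq_eq[OF this] ratio] show ?thesis
    unfolding eq by (rule trans) (rule mult.commute)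
qed

text \<open>The event \<open>R\<close> may depend on the whole sampled history. As it fixes the
  present state, every history in it has the same transition factor, which comes out of the sum over
  histories.\<close>

lemma prob_grid_step:
  assumes h: "0 < h" and H: "\<And>ys. R ys \<Longrightarrow> last ys = a" and a: "a < n" and y: "y < n"
  shows "\<P>(\<omega> in M. R (grid (\<lambda>t. X t \<omega>) h K) \<and> X (h * real (Suc K)) \<omega> = y) =
    \<P>(\<omega> in M. R (grid (\<lambda>t. X t \<omega>) h K)) * mat_exp (h \<cdot>\<^sub>m Q) $$ (a, y)"
proof -
  \<comment> \<open>Restricting to states below \<open>n\<close> and to the correct length makes the
    set of histories finite.\<close>
  define L where "L = {ys. set ys \<subseteq> {..<n} \<and> length ys = Suc K \<and> R ys}"
  have "finite {ys. set ys \<subseteq> {..<n} \<and> length ys = Suc K}"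
    by (rule finite_lists_length_eq) simp
  then have finL: "finite L" by (rule rev_finite_subset) (auto simp: L_def)
  have [measurable]: "X (h * real k) \<in> M \<rightarrow>\<^sub>M count_space UNIV"
      "X (h * (1 + real k)) \<in> M \<rightarrow>\<^sub>M count_space UNIV"
      "(\<lambda>\<omega>. grid (\<lambda>t. X t \<omega>) h K) \<in> M \<rightarrow>\<^sub>M count_space UNIV" for k
    using h by simp_all
  have grid_L: "R (grid (\<lambda>t. X t \<omega>) h K) \<longleftrightarrow> grid (\<lambda>t. X t \<omega>) h K \<in> L" if "\<omega> \<in> space M" for \<omega>
    using that h by (auto simp: L_def grid_def X_less)
  have "\<P>(\<omega> in M. R (grid (\<lambda>t. X t \<omega>) h K) \<and> X (h * real (Suc K)) \<omega> = y) =
      (\<Sum>ys\<in>L. \<P>(\<omega> in M. grid (\<lambda>t. X t \<omega>) h K = ys \<and> X (h * real (Suc K)) \<omega> = y))"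
    using grid_L by (intro prob_sum finL AE_I2) (auto simp: L_def)
  also have "\<dots> = (\<Sum>ys\<in>L. \<P>(\<omega> in M. grid (\<lambda>t. X t \<omega>) h K = ys) * mat_exp (h \<cdot>\<^sub>m Q) $$ (a, y))"
    using prob_grid_snoc[OF h _ _ y] H a by (intro sum.cong refl) (auto simp: L_def)
  also have "\<dots> = \<P>(\<omega> in M. R (grid (\<lambda>t. X t \<omega>) h K)) * mat_exp (h \<cdot>\<^sub>m Q) $$ (a, y)"
    unfolding sum_distrib_right[symmetric] using grid_L
    by (intro arg_cong2[where f = "(*)"] refl prob_sum[symmetric] finL AE_I2) (auto simp: L_def)
  finally show ?thesis .
qed

text \<open>All prefixes of \<open>v\<close> are included, since the recursion in \<open>K\<close>
  for one prefix refers to the prefix shorter by one node. The index \<open>l\<close> counts jumps,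
  hence \<open>Suc l\<close> nodes.\<close>

definition grid_prob :: "real \<Rightarrow> nat list \<Rightarrow> nat \<Rightarrow> nat \<Rightarrow> real" where
  "grid_prob h v K l =
     \<P>(\<omega> in M. remdups_adj (grid (\<lambda>t. X t \<omega>) h K) = take (Suc l) v)"

lemma grid_prob_0:
  assumes "v \<noteq> []"
  shows "grid_prob h v 0 0 = \<P>(\<omega> in M. X 0 \<omega> = v ! 0)"
  using assms by (cases v) (simp_all add: grid_prob_def grid_def)

lemma grid_prob_0_Suc:
  assumes "Suc l < length v"
  shows "grid_prob h v 0 (Suc l) = 0"
proof -
  have "take (Suc (Suc l)) v \<noteq> [x]" for x
    using assms by (auto dest!: arg_cong[of _ _ length])
  then have "[x] \<noteq> take (Suc (Suc l)) v" for x
    by metis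
  then have "{\<omega> \<in> space M. remdups_adj (grid (\<lambda>t. X t \<omega>) h 0) = take (Suc (Suc l)) v} = {}"
    by (auto simp: grid_def)
  then show ?thesis unfolding grid_prob_def by (simp only: measure_empty)
qed

lemma grid_prob_Suc_0:
  assumes "0 < h" "v \<noteq> []" "v ! 0 < n"
  shows "grid_prob h v (Suc K) 0 = grid_prob h v K 0 * mat_exp (h \<cdot>\<^sub>m Q) $$ (v ! 0, v ! 0)"
proof -
  have "remdups_adj (grid x h (Suc K)) = take 1 v \<longleftrightarrow>
      remdups_adj (grid x h K) = take 1 v \<and> x (h * real (Suc K)) = v ! 0" for x :: "real \<Rightarrow> nat"
  proof -
    have ne: "grid x h K \<noteq> []" by (simp add: grid_def)
    then have ne': "remdups_adj (grid x h K) \<noteq> []" by simp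
    obtain a v' where v: "v = a # v'" using assms(2) by (cases v) auto
    show ?thesis
      using ne ne' last_if_remdups_adj_eq_take[of "grid x h K" 0 v] assms(2)
      by (auto simp: grid_Suc remdups_adj_snoc v simp del: remdups_adj_Nil_iff)
  qed
  then show ?thesis
    using prob_grid_step[OF assms(1) _ assms(3,3), of "\<lambda>ys. remdups_adj ys = take 1 v"]
      last_if_remdups_adj_eq_take[of _ 0 v] assms(2)
    by (simp add: grid_prob_def)
qed

text \<open>The newest sample either repeats \<open>v ! Suc l\<close> or is the first to reach it,
  coming from \<open>v ! l\<close>. The two cases exclude each other, as their reduced histories
  have different lengths.\<close>

lemma grid_prob_Suc_Suc:
  assumes h: "0 < h" and l: "Suc l < length v" and n: "v ! l < n" "v ! Suc l < n"
    and neq: "v ! l \<noteq> v ! Suc l"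
  shows "grid_prob h v (Suc K) (Suc l) =
    grid_prob h v K (Suc l) * mat_exp (h \<cdot>\<^sub>m Q) $$ (v ! Suc l, v ! Suc l) +
    grid_prob h v K l * mat_exp (h \<cdot>\<^sub>m Q) $$ (v ! l, v ! Suc l)"
proof -
  have [measurable]: "X (h * real k) \<in> M \<rightarrow>\<^sub>M count_space UNIV"
      "X (h * (1 + real k)) \<in> M \<rightarrow>\<^sub>M count_space UNIV"
      "(\<lambda>\<omega>. grid (\<lambda>t. X t \<omega>) h K) \<in> M \<rightarrow>\<^sub>M count_space UNIV" for k
    using h by simp_all
  let ?R = "\<lambda>l ys. remdups_adj ys = take (Suc l) v"
  have iff: "?R (Suc l) (grid x h (Suc K)) \<longleftrightarrow>
      ?R (Suc l) (grid x h K) \<and> x (h * real (Suc K)) = v ! Suc l \<or>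
      ?R l (grid x h K) \<and> x (h * real (Suc K)) = v ! Suc l" for x :: "real \<Rightarrow> nat"
  proof -
    have ne: "grid x h K \<noteq> []" by (simp add: grid_def)
    have "take (Suc (Suc l)) v = take (Suc l) v @ [v ! Suc l]"
      using l by (rule take_Suc_conv_app_nth)
    then show ?thesis
      using ne l neq last_if_remdups_adj_eq_take[of "grid x h K" l v]
        last_if_remdups_adj_eq_take[of "grid x h K" "Suc l" v]
      by (auto simp: grid_Suc remdups_adj_snoc simp del: of_nat_Suc)
  qed
  let ?E = "\<lambda>l'. {\<omega> \<in> space M. ?R l' (grid (\<lambda>t. X t \<omega>) h K) \<and> X (h * real (Suc K)) \<omega> = v ! Suc l}"
  have "take (Suc (Suc l)) v \<noteq> take (Suc l) v"
    using l by (auto dest!: arg_cong[of _ _ length])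
  then have disj: "?E (Suc l) \<inter> ?E l = {}" by auto
  have "{\<omega> \<in> space M. ?R (Suc l) (grid (\<lambda>t. X t \<omega>) h (Suc K))} = ?E (Suc l) \<union> ?E l"
    unfolding iff by blast
  then have "grid_prob h v (Suc K) (Suc l) = prob (?E (Suc l)) + prob (?E l)"
    unfolding grid_prob_def using disj by (simp add: finite_measure_Union)
  also have "prob (?E (Suc l)) =
      grid_prob h v K (Suc l) * mat_exp (h \<cdot>\<^sub>m Q) $$ (v ! Suc l, v ! Suc l)"
    unfolding grid_prob_def using l
    by (intro prob_grid_step h n last_if_remdups_adj_eq_take)
  also have "prob (?E l) = grid_prob h v K l * mat_exp (h \<cdot>\<^sub>m Q) $$ (v ! l, v ! Suc l)"
    unfolding grid_prob_def using l
    by (intro prob_grid_step h n last_if_remdups_adj_eq_take) auto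
  finally show ?thesis .
qed

lemma grid_prob_nonneg: "0 \<le> grid_prob h v K l"
  by (simp add: grid_prob_def)

text \<open>Two applications of \<open>pascal_recursion_mono\<close>, with the sampled probabilities
  once as the smaller and once as the larger solution. Scaling by the initial probability gives the
  binomial weights the same starting values.\<close>

lemma grid_prob_bounds:
  assumes h: "0 < h" and v: "length v = Suc N" "set v \<subseteq> {..<n}"
    and neq: "\<And>l. l < N \<Longrightarrow> v ! l \<noteq> v ! Suc l"
    and d: "0 \<le> dl" "\<And>l. l \<le> N \<Longrightarrow> mat_exp (h \<cdot>\<^sub>m Q) $$ (v ! l, v ! l) \<in> {dl..du}"
    and c: "\<And>l. l < N \<Longrightarrow> 0 \<le> cl l"
      "\<And>l. l < N \<Longrightarrow> mat_exp (h \<cdot>\<^sub>m Q) $$ (v ! l, v ! Suc l) \<in> {cl l..cu l}"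
  shows "grid_prob h v K N \<in> {\<P>(\<omega> in M. X 0 \<omega> = v ! 0) * binomial_weight dl cl K N..
    \<P>(\<omega> in M. X 0 \<omega> = v ! 0) * binomial_weight du cu K N}"
proof -
  let ?p = "\<P>(\<omega> in M. X 0 \<omega> = v ! 0)"
  let ?D = "\<lambda>l. mat_exp (h \<cdot>\<^sub>m Q) $$ (v ! l, v ! l)"
  let ?C = "\<lambda>l. mat_exp (h \<cdot>\<^sub>m Q) $$ (v ! l, v ! Suc l)"
  have vn: "v ! l < n" if "l \<le> N" for l
    using v that by (metis le_imp_less_Suc lessThan_iff nth_mem subsetD)
  have ne: "v \<noteq> []" using v by auto
  have g: "grid_prob h v (Suc K) 0 = grid_prob h v K 0 * ?D 0"
    "l < N \<Longrightarrow> grid_prob h v (Suc K) (Suc l) = grid_prob h v K (Suc l) * ?D (Suc l) + grid_prob h v K l * ?C l" for K l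
    using v vn neq by (auto intro!: grid_prob_Suc_0[OF h] grid_prob_Suc_Suc[OF h])
  have w: "?p * binomial_weight d c (Suc K) 0 = ?p * binomial_weight d c K 0 * d"
    "?p * binomial_weight d c (Suc K) (Suc l) = ?p * binomial_weight d c K (Suc l) * d + ?p * binomial_weight d c K l * c l"
    for d c K l by (simp_all add: binomial_weight_simps binomial_weight_Suc_Suc algebra_simps)
  have init: "grid_prob h v 0 l = ?p * binomial_weight d c 0 l" if "l \<le> N" for d c l
    using that v grid_prob_0[OF ne, of h]
    by (cases l) (auto simp: grid_prob_0_Suc binomial_weight_simps)
  have "grid_prob h v K N \<le> ?p * binomial_weight du cu K N"
  proof (rule pascal_recursion_mono[where f = "grid_prob h v" and g = "\<lambda>K l. ?p * binomial_weight du cu K l"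
      and d = ?D and d' = "\<lambda>_. du" and c = ?C and c' = cu and N = N])
    show "0 \<le> ?D l \<and> ?D l \<le> du" if "l \<le> N" for l using d(1) d(2)[OF that] by auto
    show "0 \<le> ?C l \<and> ?C l \<le> cu l" if "l < N" for l using c(1)[OF that] c(2)[OF that] by auto
    show "grid_prob h v 0 l \<le> ?p * binomial_weight du cu 0 l" if "l \<le> N" for l
      using init[OF that, of du cu] by simp
  qed (rule g w grid_prob_nonneg order.refl; assumption?)+
  moreover have "?p * binomial_weight dl cl K N \<le> grid_prob h v K N"
  proof (rule pascal_recursion_mono[where g = "grid_prob h v" and f = "\<lambda>K l. ?p * binomial_weight dl cl K l"
      and d' = ?D and d = "\<lambda>_. dl" and c' = ?C and c = cl and N = N])
    show "0 \<le> dl \<and> dl \<le> ?D l" if "l \<le> N" for l using d(1) d(2)[OF that] by auto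
    show "0 \<le> cl l \<and> cl l \<le> ?C l" if "l < N" for l using c(1)[OF that] c(2)[OF that] by auto
    show "?p * binomial_weight dl cl 0 l \<le> grid_prob h v 0 l" if "l \<le> N" for l
      using init[OF that, of dl cl] by simp
    show "0 \<le> ?p * binomial_weight dl cl K l" if "l \<le> N" for K l
      using that d(1) c(1) by (intro mult_nonneg_nonneg binomial_weight_nonneg) auto
  qed (rule g w order.refl; assumption?)+
  ultimately show ?thesis by simp
qed

section \<open>From sampled probabilities to path probabilities\<close>

lemma tendsto_grid_prob:
  assumes "0 < b" and v: "length v = Suc N"
  shows "(\<lambda>K. grid_prob (b / real K) v K N) \<longlonglongrightarrow> path_prob M X b N v"
proof -
  let ?P = "\<lambda>\<omega>. exactly_jumps N b (\<lambda>t. X t \<omega>) \<and> (\<forall>k\<le>N. jump_chain (\<lambda>t. X t \<omega>) k = v ! k)"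
  let ?R = "\<lambda>K \<omega>. remdups_adj (grid (\<lambda>t. X t \<omega>) (b / real K) K) = v"
  let ?A = "\<lambda>K. {\<omega> \<in> space M. ?R K \<omega>}"
  let ?B = "{\<omega> \<in> space M. ?P \<omega>}"
  have A: "?A K \<in> events" for K
  proof -
    have [measurable]: "(\<lambda>\<omega>. grid (\<lambda>t. X t \<omega>) (b / real K) K) \<in> M \<rightarrow>\<^sub>M count_space UNIV"
      using \<open>0 < b\<close> by simp
    show ?thesis by measurable
  qed
  have lim: "(\<lambda>K. indicator (?A K) \<omega> :: real) \<longlonglongrightarrow> indicator ?B \<omega>" if "\<omega> \<in> space M" for \<omega>
  proof (rule tendsto_eventually)
    show "eventually (\<lambda>K. indicator (?A K) \<omega> = (indicator ?B \<omega> :: real)) sequentially"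
      using eventually_grid_iff_jumps[OF rc_step_path_X[OF that] \<open>0 < b\<close> v]
      by eventually_elim (auto simp: indicator_def that)
  qed
  \<comment> \<open>The event \<open>?B\<close> is phrased through infima over uncountably many
    times. Its measurability is obtained from its being a pointwise limit of grid events.\<close>
  have ind: "(indicator ?B :: 'w \<Rightarrow> real) \<in> borel_measurable M"
    using A by (intro borel_measurable_LIMSEQ_real[OF lim]) auto
  then have B: "?B \<in> events"
    by (simp add: borel_measurable_indicator_iff Int_absorb2)
  have "(\<lambda>K. \<integral>\<omega>. indicator (?A K) \<omega> \<partial>M) \<longlonglongrightarrow> (\<integral>\<omega>. indicator ?B \<omega> \<partial>M :: real)"
  proof (rule integral_dominated_convergence[where w = "\<lambda>_. 1"])
    show "AE \<omega> in M. (\<lambda>K. indicator (?A K) \<omega> :: real) \<longlonglongrightarrow> indicator ?B \<omega>"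
      using lim by (rule AE_I2)
    show "AE \<omega> in M. norm (indicator (?A K) \<omega> :: real) \<le> 1" for K
      by (simp add: indicator_def)
  qed (use A ind in simp_all)
  then show ?thesis
    using A B v by (simp add: grid_prob_def path_prob_def)
qed

text \<open>A squeeze: the transition factors over time \<open>h\<close> are
  \<open>1 - a * h\<close> and \<open>c l * h\<close> up to \<open>e * h^2\<close>, and the binomial
  weights for both signs of this error have the same limit.\<close>

lemma path_prob_eq:
  assumes Q: "Q \<in> carrier_mat n n" and b: "0 < b"
    and v: "length v = Suc N" "set v \<subseteq> {..<n}"
    and neq: "\<And>l. l < N \<Longrightarrow> v ! l \<noteq> v ! Suc l"
    and a: "\<And>l. l \<le> N \<Longrightarrow> Q $$ (v ! l, v ! l) = - a"
    and c: "\<And>l. l < N \<Longrightarrow> Q $$ (v ! l, v ! Suc l) > 0"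
  shows "path_prob M X b N v = \<P>(\<omega> in M. X 0 \<omega> = v ! 0) *
    (b ^ N / fact N * exp (- a * b) * (\<Prod>l<N. Q $$ (v ! l, v ! Suc l)))"
proof -
  define c where "c l = Q $$ (v ! l, v ! Suc l)" for l
  \<comment> \<open>A crude common bound for all entries of \<open>Q\<close>. For the matrix scaled
    by \<open>h\<close> the second-order error is then at most \<open>(n * h * q)^2\<close>, which
    explains \<open>e\<close>.\<close>
  define q where "q = (\<Sum>x<n. \<Sum>y<n. \<bar>Q $$ (x, y)\<bar>)"
  have q: "\<bar>Q $$ (x, y)\<bar> \<le> q" if "x < n" "y < n" for x y
  proof -
    have "\<bar>Q $$ (x, y)\<bar> \<le> (\<Sum>y<n. \<bar>Q $$ (x, y)\<bar>)"
      using that by (intro member_le_sum) auto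
    also have "\<dots> \<le> q"
      unfolding q_def using that by (intro member_le_sum) (auto intro: sum_nonneg)
    finally show ?thesis .
  qed
  define e where "e = (real n * q)\<^sup>2"
  have vn: "v ! l < n" if "l \<le> N" for l
    using v that by (metis le_imp_less_Suc lessThan_iff nth_mem subsetD)
  have exp_Q: "\<bar>mat_exp (h \<cdot>\<^sub>m Q) $$ (x, y) - (if x = y then 1 else 0) - h * Q $$ (x, y)\<bar> \<le> e * h\<^sup>2"
    if "0 < h" "h * (real n * q) < 1" "x < n" "y < n" for h x y
  proof -
    have "\<bar>mat_exp (h \<cdot>\<^sub>m Q) $$ (x, y) - (if x = y then 1 else 0) - (h \<cdot>\<^sub>m Q) $$ (x, y)\<bar>
        \<le> (real n * (h * q))\<^sup>2"
      using that Q q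
      by (intro mat_exp_second_order[where n = n]) (auto simp: abs_mult mult_ac intro!: mult_left_mono)
    then show ?thesis using that Q by (simp add: e_def power_mult_distrib mult_ac)
  qed
  define h where "h K = b / real K" for K
  \<comment> \<open>The signs \<open>s = - e\<close> and \<open>s = e\<close> give the lower and the
    upper bound.\<close>
  define W where "W s K = binomial_weight (1 - a * h K + s * (h K)\<^sup>2)
      (\<lambda>l. c l * h K + s * (h K)\<^sup>2) K N" for s K
  let ?p = "\<P>(\<omega> in M. X 0 \<omega> = v ! 0)"
  let ?L = "?p * (b ^ N / fact N * exp (- a * b) * (\<Prod>l<N. c l))"
  have lim: "(\<lambda>K. ?p * W s K) \<longlonglongrightarrow> ?L" for s
    unfolding W_def h_def by (intro tendsto_mult_left tendsto_perturbed_binomial_weight)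
  have h0: "h \<longlonglongrightarrow> 0"
    unfolding h_def by (rule lim_const_over_n)
  have "(\<lambda>K. h K * (real n * q)) \<longlonglongrightarrow> 0 * (real n * q)"
    by (intro tendsto_intros h0)
  then have ev1: "eventually (\<lambda>K. h K * (real n * q) < 1) sequentially"
    by (intro order_tendstoD(2)[of _ 0]) auto
  have "(\<lambda>K. 1 - a * h K + (- e) * (h K)\<^sup>2) \<longlonglongrightarrow> 1 - a * 0 + (- e) * 0\<^sup>2"
    by (intro tendsto_intros h0)
  then have ev2: "eventually (\<lambda>K. 0 < 1 - a * h K + (- e) * (h K)\<^sup>2) sequentially"
    by (intro order_tendstoD(1)[of _ 1]) auto
  \<comment> \<open>The lower jump factor is \<open>h * (c l - e * h)\<close>, so positivity of the
    rates makes it nonnegative for small \<open>h\<close>, as the comparison demands.\<close>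
  have "eventually (\<lambda>K. 0 < c l + (- e) * h K) sequentially" if "l < N" for l
  proof (rule order_tendstoD(1))
    show "(\<lambda>K. c l + (- e) * h K) \<longlonglongrightarrow> c l + (- e) * 0"
      by (intro tendsto_intros h0)
  qed (use c[OF that] in \<open>simp add: c_def\<close>)
  then have ev3: "eventually (\<lambda>K. \<forall>l\<in>{..<N}. 0 < c l + (- e) * h K) sequentially"
    by (intro eventually_ball_finite) auto
  have "eventually (\<lambda>K. grid_prob (h K) v K N \<in> {?p * W (- e) K..?p * W e K}) sequentially"
    using ev1 ev2 ev3 eventually_gt_at_top[of 0]
  proof eventually_elim
    case (elim K)
    have hK: "0 < h K" using elim b by (simp add: h_def)
    show ?case
      unfolding W_def
    proof (rule grid_prob_bounds[OF hK v neq])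
      show "0 \<le> 1 - a * h K + - e * (h K)\<^sup>2" using elim by simp
      show "mat_exp (h K \<cdot>\<^sub>m Q) $$ (v ! l, v ! l) \<in>
          {1 - a * h K + - e * (h K)\<^sup>2..1 - a * h K + e * (h K)\<^sup>2}" if "l \<le> N" for l
        using exp_Q[OF hK elim(1) vn[OF that] vn[OF that]] a[OF that] by (simp add: abs_le_iff algebra_simps)
      show "0 \<le> c l * h K + - e * (h K)\<^sup>2" if "l < N" for l
      proof -
        have "0 \<le> (c l + (- e) * h K) * h K" using elim(3) that hK by (intro mult_nonneg_nonneg less_imp_le) auto
        then show ?thesis by (simp add: power2_eq_square algebra_simps)
      qed
      show "mat_exp (h K \<cdot>\<^sub>m Q) $$ (v ! l, v ! Suc l) \<in>
          {c l * h K + - e * (h K)\<^sup>2..c l * h K + e * (h K)\<^sup>2}" if "l < N" for l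
        using exp_Q[OF hK elim(1) vn[of l] vn[of "Suc l"]] that neq[OF that]
        by (simp add: abs_le_iff c_def algebra_simps)
    qed
  qed
  then have "(\<lambda>K. grid_prob (h K) v K N) \<longlonglongrightarrow> ?L"
    by (intro tendsto_sandwich[OF _ _ lim[of "- e"] lim[of e]]) (auto elim: eventually_mono)
  moreover have "(\<lambda>K. grid_prob (h K) v K N) \<longlonglongrightarrow> path_prob M X b N v"
    unfolding h_def by (rule tendsto_grid_prob[OF b v(1)])
  ultimately show ?thesis
    unfolding c_def by (rule LIMSEQ_unique[symmetric])
qed

end

section \<open>Ruelle-Bowen random walks\<close>

lemma rb_generator_carrier: "rb_generator n G \<phi> \<in> carrier_mat n n"
  unfolding rb_generator_def adjacency_mat_def
  by (intro minus_carrier_mat smult_carrier_mat one_carrier_mat)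

lemma rb_generator_index:
  assumes "x < n" "y < n"
  shows "rb_generator n G \<phi> $$ (x, y) =
    inverse (vec_index \<phi> x) * (if (x, y) \<in> parcs G then 1 else 0) * vec_index \<phi> y -
    (if x = y then fp_eigenvalue (adjacency_mat n G) else 0)"
proof -
  have A: "adjacency_mat n G \<in> carrier_mat n n" by (simp add: adjacency_mat_def)
  then show ?thesis
    using assms unfolding rb_generator_def mat_diag_mult_left[OF A]
    by (subst mat_diag_mult_right[of _ n n]) (auto simp: adjacency_mat_def)
qed

text \<open>The explicit value involves only \<open>i\<close>, \<open>j\<close>, \<open>N\<close>,
  \<open>tf\<close> and data of the walk. Absence of loops enters twice: it makes every diagonal
  entry of the generator equal to minus the eigenvalue, and it makes consecutive nodes of a path
  distinct.\<close>

lemma path_prob_ruelle_bowen: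
  fixes \<phi> :: "real Matrix.vec"
  assumes G: "pair_loopfree_digraph G" "pverts G = {0..<n}"
    and \<phi>: "\<And>k. k < n \<Longrightarrow> vec_index \<phi> k > 0"
    and X: "markov_jump_process M n (rb_generator n G \<phi>) X"
    and "tf > 0" "i < n" and v: "step_path_between G N i j v"
  shows "path_prob M X tf N v = \<P>(\<omega> in M. X 0 \<omega> = i) *
    (tf ^ N / fact N * exp (- fp_eigenvalue (adjacency_mat n G) * tf) *
      (vec_index \<phi> j / vec_index \<phi> i))"
proof -
  interpret pair_loopfree_digraph G by fact
  interpret jump_process M n "rb_generator n G \<phi>" X by unfold_locales fact
  have len: "length v = Suc N" and v0: "v ! 0 = i" and vN: "v ! N = j"
    and arc: "\<And>l. l < N \<Longrightarrow> (v ! l, v ! Suc l) \<in> parcs G"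
    using v by (auto simp: step_path_between_def)
  \<comment> \<open>The first node is \<open>i\<close>; every later node is the head of an arc and
    hence a vertex.\<close>
  have vn: "v ! l < n" if "l \<le> N" for l
  proof (cases l)
    case 0
    then show ?thesis using v0 \<open>i < n\<close> by simp
  next
    case (Suc l')
    then show ?thesis using in_arcsD2[OF arc[of l']] that G(2) by simp
  qed
  have noloop: "(x, x) \<notin> parcs G" for x
    using no_loops[of "(x, x)"] by auto
  have neq: "v ! l \<noteq> v ! Suc l" if "l < N" for l
    using arc[OF that] noloop[of "v ! l"] by auto
  have jump: "rb_generator n G \<phi> $$ (v ! l, v ! Suc l) = vec_index \<phi> (v ! Suc l) / vec_index \<phi> (v ! l)"
    if "l < N" for l
    using that vn[of l] vn[of "Suc l"] arc neq by (simp add: rb_generator_index field_simps)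
  \<comment> \<open>Stated for every initial segment so that induction applies; positivity of the
    eigenvector entries permits the cancellation.\<close>
  have telescope: "(\<Prod>l<k. vec_index \<phi> (v ! Suc l) / vec_index \<phi> (v ! l)) =
      vec_index \<phi> (v ! k) / vec_index \<phi> (v ! 0)" if "k \<le> N" for k
    using that
  proof (induction k)
    case 0
    then show ?case using \<phi>[OF vn[of 0]] by simp
  next
    case (Suc k)
    then show ?case using \<phi>[OF vn[of k]] by simp
  qed
  have "path_prob M X tf N v = \<P>(\<omega> in M. X 0 \<omega> = v ! 0) *
    (tf ^ N / fact N * exp (- fp_eigenvalue (adjacency_mat n G) * tf) *
      (\<Prod>l<N. rb_generator n G \<phi> $$ (v ! l, v ! Suc l)))"
  proof (rule path_prob_eq[OF rb_generator_carrier \<open>tf > 0\<close> len _ neq])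
    show "set v \<subseteq> {..<n}" using vn len by (auto simp: in_set_conv_nth less_Suc_eq_le)
    show "rb_generator n G \<phi> $$ (v ! l, v ! l) = - fp_eigenvalue (adjacency_mat n G)" if "l \<le> N" for l
      using vn[OF that] noloop by (simp add: rb_generator_index)
    show "rb_generator n G \<phi> $$ (v ! l, v ! Suc l) > 0" if "l < N" for l
      using that jump \<phi> vn by simp
  qed
  also have "(\<Prod>l<N. rb_generator n G \<phi> $$ (v ! l, v ! Suc l)) = vec_index \<phi> j / vec_index \<phi> i"
    using telescope[of N] jump v0 vN by simp
  finally show ?thesis by (simp only: v0)
qed

theorem theorem2:
  fixes n N i j :: nat
    and G :: "nat pair_pre_digraph"
    and \<phi> :: "real Matrix.vec"
    and M :: "'w measure"
    and X :: "real \<Rightarrow> 'w \<Rightarrow> nat"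
    and tf :: real
    and v w :: "nat list"
  assumes "n \<ge> 2"
    and "pverts G = {0..<n}"
    and "pair_loopfree_digraph G"
    and "strongly_connected (with_proj G)"
    and "eigenvector (adjacency_mat n G) \<phi> (fp_eigenvalue (adjacency_mat n G))"
    and "\<And>k. k < n \<Longrightarrow> vec_index \<phi> k > 0"
    and "markov_jump_process M n (rb_generator n G \<phi>) X"
    and "tf > 0"
    and "i \<in> pverts G"
    and "j \<in> pverts G"
    and "step_path_between G N i j v"
    and "step_path_between G N i j w"
  shows "path_prob M X tf N v = path_prob M X tf N w"
proof -
  have "i < n" using assms(2,9) by simp
  then show ?thesis
    using path_prob_ruelle_bowen[OF assms(3,2,6,7,8) _ assms(11)]
      path_prob_ruelle_bowen[OF assms(3,2,6,7,8) _ assms(12)] by simp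
qed

end
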